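(* Let $\mathbb{F}$ be an arbitrary field, $n\ge 3$ and $m\ge 2$. The $\mathrm{GL}_n$-orbits on $M_n^m$ are not separated by abstract invariants of width one; that is, there exist $\underline{A},\underline{B}\in M_n^m$ with $\mathrm{GL}_n\cdot\underline{A}\ne\mathrm{GL}_n\cdot\underline{B}$ such that $f(\underline{A})=f(\underline{B})$ for every abstract invariant $f\in\mathcal{F}_{n,m}^{\mathrm{GL}_n}$ of width one. In particular, the two-sided Curto–Herrero conjecture does not hold in general for $n\ge 3$ and $m\ge 2$: there exist $\underline{A},\underline{B}\in M_n^m$ with $\mathrm{GL}_n\cdot\underline{A}\ne\mathrm{GL}_n\cdot\underline{B}$ such that $\mathrm{rank}\,f(\underline{A})=\mathrm{rank}\,f(\underline{B})$ for every non-commutative polynomial $f$ over $\mathbb{F}$ in $m$ variables (possibly with a free term).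
   Context: $M_n$ is the space of $n\times n$ matrices over $\mathbb{F}$, and $\mathrm{GL}_n=\mathrm{GL}_n(\mathbb{F})$ acts on $M_n^m$ by simultaneous conjugation: $g\cdot(A_1,\ldots,A_m)=(gA_1g^{-1},\ldots,gA_mg^{-1})$. For $1\le k\le m$, $X_k=(x_{ij}(k))_{1\le i,j\le n}$ is the generic $n\times n$ matrix whose entries are independent commuting variables, and $\mathrm{alg}_{\mathbb{F}}\{X\}_m$ is the associative $\mathbb{F}$-algebra generated by $X_1,\ldots,X_m$ and the identity matrix $I_n$. For $F\in \mathrm{alg}_{\mathbb{F}}\{X\}_m$ and $\underline{A}\in M_n^m$, $F(\underline{A})\in M_n$ is the result of substituting $X_k\mapsto A_k$. An abstract (matrix) invariant on $M_n^m$ is an arbitrary function $f:M_n^m\to\mathbb{F}$ with $f(g\cdot\underline{A})=f(\underline{A})$ for all $g\in\mathrm{GL}_n$, $\underline{A}\in M_n^m$; these form the algebra $\mathcal{F}_{n,m}^{\mathrm{GL}_n}$. The width of $f\in \mathcal{F}_{n,m}^{\mathrm{GL}_n}$ is the smallest $d>0$ such that there are $h\in\mathcal{F}_{n,d}^{\mathrm{GL}_n}$ and $F_1,\ldots,F_d\in \mathrm{alg}_{\mathbb{F}}\{X\}_m$ with $f(\underline{A})=h(F_1(\underline{A}),\ldots,F_d(\underline{A}))$ for all $\underline{A}\in M_n^m$. The two-sided Curto–Herrero conjecture asserts that for every $\underline{A},\underline{B}\in M_n^m$ the $\mathrm{GL}_n$-orbits of $\underline{A}$ and $\underline{B}$ coincide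 if and only if $\mathrm{rank}\,f(\underline{A})=\mathrm{rank}\,f(\underline{B})$ for every non-commutative polynomial $f$ in $m$ variables (possibly with a free term). *)

theory Defs
  imports
    "HOL-Library.Poly_Mapping"
    "Jordan_Normal_Form.DL_Rank"
begin

section \<open>Simultaneous conjugation of matrix tuples\<close>

definition mat_tuples :: "nat \<Rightarrow> nat \<Rightarrow> 'a mat list set" where
  "mat_tuples n m = {As. length As = m \<and> set As \<subseteq> carrier_mat n n}"

definition GL :: "nat \<Rightarrow> 'a :: field mat set" where
  "GL n = Units (ring_mat TYPE('a) n ())"

definition conj_act :: "nat \<Rightarrow> 'a :: field mat \<Rightarrow> 'a mat list \<Rightarrow> 'a mat list" where
  "conj_act n g As = map (\<lambda>A. g * A * inv\<^bsub>ring_mat TYPE('a) n ()\<^esub> g) As"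

definition GL_orbit :: "nat \<Rightarrow> 'a :: field mat list \<Rightarrow> 'a mat list set" where
  "GL_orbit n As = (\<lambda>g. conj_act n g As) ` GL n"

text \<open>Abstract invariants are functions on the set of tuples; only their values on
  \<^term>\<open>mat_tuples n m\<close> are meaningful, the values elsewhere are unconstrained.\<close>

definition abstract_invariants :: "nat \<Rightarrow> nat \<Rightarrow> ('a :: field mat list \<Rightarrow> 'a) set" where
  "abstract_invariants n m =
    {f. \<forall>g \<in> GL n. \<forall>As \<in> mat_tuples n m. f (conj_act n g As) = f As}"

section \<open>The algebra of generic matrices\<close>

text \<open>Commutative polynomials in the variables $x_{ij}(k)$, indexed by the triples
  $(i,j,k)$: a finitely supported map from exponent vectors to coefficients.
  All indices, including $k$, start at $0$.\<close>

type_synonym 'a entry_poly = "(nat \<times> nat \<times> nat \<Rightarrow>\<^sub>0 nat) \<Rightarrow>\<^sub>0 'a"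

definition entry_var :: "nat \<Rightarrow> nat \<Rightarrow> nat \<Rightarrow> 'a :: field entry_poly" where
  "entry_var i j k = Poly_Mapping.single (Poly_Mapping.single (i, j, k) 1) 1"

definition entry_const :: "'a :: field \<Rightarrow> 'a entry_poly" where
  "entry_const c = Poly_Mapping.single 0 c"

definition entry_eval :: "(nat \<times> nat \<times> nat \<Rightarrow> 'a) \<Rightarrow> 'a :: field entry_poly \<Rightarrow> 'a" where
  "entry_eval v p = (\<Sum>\<mu> \<in> Poly_Mapping.keys p. Poly_Mapping.lookup p \<mu> *
     (\<Prod>x \<in> Poly_Mapping.keys \<mu>. v x ^ Poly_Mapping.lookup \<mu> x))"

definition generic_mat :: "nat \<Rightarrow> nat \<Rightarrow> 'a :: field entry_poly mat" where
  "generic_mat n k = mat n n (\<lambda>(i, j). entry_var i j k)"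

inductive_set generic_alg :: "nat \<Rightarrow> nat \<Rightarrow> 'a :: field entry_poly mat set"
  for n m :: nat
where
  gen: "k < m \<Longrightarrow> generic_mat n k \<in> generic_alg n m"
| one: "1\<^sub>m n \<in> generic_alg n m"
| add: "F \<in> generic_alg n m \<Longrightarrow> G \<in> generic_alg n m \<Longrightarrow> F + G \<in> generic_alg n m"
| mult: "F \<in> generic_alg n m \<Longrightarrow> G \<in> generic_alg n m \<Longrightarrow> F * G \<in> generic_alg n m"
| scale: "F \<in> generic_alg n m \<Longrightarrow> entry_const c \<cdot>\<^sub>m F \<in> generic_alg n m"

definition generic_subst :: "'a :: field entry_poly mat \<Rightarrow> 'a mat list \<Rightarrow> 'a mat" where
  "generic_subst F As = map_mat (entry_eval (\<lambda>(i, j, k). (As ! k) $$ (i, j))) F"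

text \<open>The set below contains \<^term>\<open>m\<close> for every invariant when \<^term>\<open>0 < m\<close>
  (take the generic matrices themselves), so the minimum exists.\<close>

definition inv_width :: "nat \<Rightarrow> nat \<Rightarrow> ('a :: field mat list \<Rightarrow> 'a) \<Rightarrow> nat" where
  "inv_width n m f = (LEAST d. 0 < d \<and>
     (\<exists>h \<in> abstract_invariants n d. \<exists>Fs. length Fs = d \<and> set Fs \<subseteq> generic_alg n m \<and>
        (\<forall>As \<in> mat_tuples n m. f As = h (map (\<lambda>F. generic_subst F As) Fs))))"

section \<open>Non-commutative polynomials and the two-sided Curto--Herrero conjecture\<close>

text \<open>A non-commutative polynomial is a finitely supported map from words, i.e. lists of
  letters below \<^term>\<open>m\<close>, to coefficients; the empty word carries the free term.\<close>

definition nc_polys :: "nat \<Rightarrow> (nat list \<Rightarrow>\<^sub>0 'a :: field) set" where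
  "nc_polys m = {f. Poly_Mapping.keys f \<subseteq> lists {..<m}}"

definition word_eval :: "nat \<Rightarrow> 'a :: field mat list \<Rightarrow> nat list \<Rightarrow> 'a mat" where
  "word_eval n As w = foldr (\<lambda>k M. As ! k * M) w (1\<^sub>m n)"

definition nc_eval :: "nat \<Rightarrow> (nat list \<Rightarrow>\<^sub>0 'a :: field) \<Rightarrow> 'a mat list \<Rightarrow> 'a mat" where
  "nc_eval n f As = finsum (ring_mat TYPE('a) n ())
     (\<lambda>w. Poly_Mapping.lookup f w \<cdot>\<^sub>m word_eval n As w) (Poly_Mapping.keys f)"

definition two_sided_curto_herrero :: "'a :: field itself \<Rightarrow> nat \<Rightarrow> nat \<Rightarrow> bool" where
  "two_sided_curto_herrero _ n m \<longleftrightarrow>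
    (\<forall>As \<in> mat_tuples n m. \<forall>Bs \<in> mat_tuples n m :: 'a mat list set.
       GL_orbit n As = GL_orbit n Bs \<longleftrightarrow>
       (\<forall>f \<in> nc_polys m. vec_space.rank n (nc_eval n f As) = vec_space.rank n (nc_eval n f Bs)))"

end

theory Submission
  imports Defs
begin

text \<open>Take \<open>A = (E\<^sub>1\<^sub>2, E\<^sub>1\<^sub>3, 0, \<dots>)\<close> and let \<open>B\<close> consist of the transposes. All products of
  entries of \<open>A\<close> vanish, so a polynomial \<open>F\<close> takes values \<open>F(A) = c + a E\<^sub>1\<^sub>2 + b E\<^sub>1\<^sub>3\<close> and
  \<open>F(B) = F(A)\<^sup>T\<close>. These are conjugate, so \<open>A\<close> and \<open>B\<close> agree on every invariant of width one and
  on all ranks. The conjugating matrix depends on \<open>a\<close> and \<open>b\<close>, however, and no single one carries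
  \<open>B\<close> to \<open>A\<close>: the entries of \<open>A\<close> have a common kernel of dimension \<open>n - 2\<close>, those of \<open>B\<close> one of
  dimension \<open>n - 1\<close>.\<close>

section \<open>Evaluation of polynomials at generic entries\<close>

definition monom_eval :: "('v \<Rightarrow> 'a :: comm_semiring_1) \<Rightarrow> ('v \<Rightarrow>\<^sub>0 nat) \<Rightarrow> 'a" where
  "monom_eval v \<mu> = (\<Prod>x \<in> Poly_Mapping.keys \<mu>. v x ^ Poly_Mapping.lookup \<mu> x)"

text \<open>Variables outside the support contribute factors \<open>v x ^ 0 = 1\<close>. Two
  monomials can thus be written over one common index set and multiplied factor by factor.\<close>

lemma monom_eval_superset:
  assumes "finite S" "Poly_Mapping.keys \<mu> \<subseteq> S"
  shows "monom_eval v \<mu> = (\<Prod>x \<in> S. v x ^ Poly_Mapping.lookup \<mu> x)"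
  unfolding monom_eval_def
  by (rule prod.mono_neutral_left) (use assms in \<open>auto simp: in_keys_iff\<close>)

lemma monom_eval_zero [simp]: "monom_eval v 0 = 1"
  by (simp add: monom_eval_def)

lemma monom_eval_add: "monom_eval v (\<mu> + \<nu>) = monom_eval v \<mu> * monom_eval v \<nu>"
proof -
  let ?S = "Poly_Mapping.keys \<mu> \<union> Poly_Mapping.keys \<nu>"
  have "Poly_Mapping.keys (\<mu> + \<nu>) \<subseteq> ?S" by (rule keys_add)
  then show ?thesis
    by (simp add: monom_eval_superset[of ?S] lookup_add power_add prod.distrib)
qed

lemma entry_eval_monom:
  "entry_eval v p = (\<Sum>\<mu> \<in> Poly_Mapping.keys p. Poly_Mapping.lookup p \<mu> * monom_eval v \<mu>)"
  by (simp add: entry_eval_def monom_eval_def)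

lemma entry_eval_zero [simp]: "entry_eval v 0 = 0"
  by (simp add: entry_eval_monom)

lemma entry_eval_add: "entry_eval v (p + q) = entry_eval v p + entry_eval v q"
  unfolding entry_eval_monom
  by (rule setsum_keys_plus_distrib) (simp_all add: algebra_simps)

lemma entry_eval_sum: "entry_eval v (sum f A) = (\<Sum>x\<in>A. entry_eval v (f x))"
  by (induction A rule: infinite_finite_induct) (simp_all add: entry_eval_add)

lemma entry_eval_single: "entry_eval v (Poly_Mapping.single \<mu> c) = c * monom_eval v \<mu>"
  by (simp add: entry_eval_monom)

lemma sum_single_keys:
  "p = (\<Sum>k \<in> Poly_Mapping.keys p. Poly_Mapping.single k (Poly_Mapping.lookup p k))"
  by (rule poly_mapping_eqI)
    (auto simp: lookup_sum lookup_single when_def in_keys_iff sum.delta)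

text \<open>Expanding both factors into single terms reduces the claim to monomials, where it is
  \<open>monom_eval_add\<close>.\<close>

lemma entry_eval_mult: "entry_eval v (p * q) = entry_eval v p * entry_eval v q"
proof -
  have "p * q = (\<Sum>k \<in> Poly_Mapping.keys p. \<Sum>l \<in> Poly_Mapping.keys q.
      Poly_Mapping.single (k + l) (Poly_Mapping.lookup p k * Poly_Mapping.lookup q l))"
    by (subst sum_single_keys[of p], subst sum_single_keys[of q])
      (simp add: sum_product mult_single)
  then show ?thesis
    by (simp add: entry_eval_sum entry_eval_single monom_eval_add)
      (simp add: entry_eval_monom sum_product algebra_simps)
qed

lemma entry_eval_one [simp]: "entry_eval v 1 = 1"
  by (simp add: entry_eval_single flip: single_one)

lemma entry_eval_const [simp]: "entry_eval v (entry_const c) = c"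
  by (simp add: entry_const_def entry_eval_single)

lemma entry_eval_var [simp]: "entry_eval v (entry_var i j k) = v (i, j, k)"
  by (simp add: entry_var_def entry_eval_single monom_eval_def)

lemma comm_ring_hom_entry_eval: "comm_ring_hom (entry_eval v)"
  by unfold_locales (simp_all add: entry_eval_add entry_eval_mult)

lemma generic_alg_carrier: "F \<in> generic_alg n m \<Longrightarrow> F \<in> carrier_mat n n"
  by (induction rule: generic_alg.induct) (auto simp: generic_mat_def)

lemma generic_subst_add:
  "F \<in> carrier_mat n n \<Longrightarrow> G \<in> carrier_mat n n \<Longrightarrow>
    generic_subst (F + G) As = generic_subst F As + generic_subst G As"
  by (rule eq_matI) (auto simp: generic_subst_def entry_eval_add)

lemma generic_subst_mult:
  assumes "F \<in> carrier_mat n n" "G \<in> carrier_mat n n"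
  shows "generic_subst (F * G) As = generic_subst F As * generic_subst G As"
  using semiring_hom.mat_hom_mult[OF _ assms] comm_ring_hom_entry_eval
  unfolding generic_subst_def comm_ring_hom_def ring_hom_def by blast

lemma generic_subst_scale:
  "generic_subst (entry_const c \<cdot>\<^sub>m F) As = c \<cdot>\<^sub>m generic_subst F As"
  by (rule eq_matI) (auto simp: generic_subst_def entry_eval_mult)

lemma generic_subst_one: "generic_subst (1\<^sub>m n) As = 1\<^sub>m n"
  by (rule eq_matI) (auto simp: generic_subst_def)

lemma generic_subst_generic_mat:
  "As ! k \<in> carrier_mat n n \<Longrightarrow> generic_subst (generic_mat n k) As = As ! k"
  by (rule eq_matI) (auto simp: generic_subst_def generic_mat_def)

section \<open>Invariants of width one\<close>

text \<open>The least number in the definition of the width is attained, since the generic matrices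
  themselves present every invariant with \<open>m\<close> arguments.\<close>

lemma inv_width_attained:
  assumes "0 < m" and f: "f \<in> abstract_invariants n m"
  shows "\<exists>h \<in> abstract_invariants n (inv_width n m f). \<exists>Fs. length Fs = inv_width n m f \<and>
    set Fs \<subseteq> generic_alg n m \<and>
    (\<forall>As \<in> mat_tuples n m. f As = h (map (\<lambda>F. generic_subst F As) Fs))"
proof -
  let ?P = "\<lambda>d. 0 < d \<and> (\<exists>h \<in> abstract_invariants n d. \<exists>Fs. length Fs = d \<and>
    set Fs \<subseteq> generic_alg n m \<and>
    (\<forall>As \<in> mat_tuples n m. f As = h (map (\<lambda>F. generic_subst F As) Fs)))"
  let ?Fs = "map (generic_mat n) [0..<m]"
  have "map (\<lambda>F. generic_subst F As) ?Fs = As" if "As \<in> mat_tuples n m" for As :: "'a mat list"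
  proof (rule nth_equalityI)
    show "map (\<lambda>F. generic_subst F As) ?Fs ! k = As ! k"
      if "k < length (map (\<lambda>F. generic_subst F As) ?Fs)" for k
      using that \<open>As \<in> mat_tuples n m\<close>
      by (auto simp: mat_tuples_def intro!: generic_subst_generic_mat)
  qed (use that in \<open>auto simp: mat_tuples_def\<close>)
  moreover have "set ?Fs \<subseteq> generic_alg n m"
    by (auto intro: generic_alg.gen)
  ultimately have "?P m"
    using assms by (intro conjI bexI[OF _ f] exI[of _ ?Fs]) auto
  then have "?P (LEAST d. ?P d)" by (rule LeastI)
  then show ?thesis unfolding inv_width_def by blast
qed

text \<open>A width-one invariant sees a tuple only through one matrix \<open>F(A)\<close>.
  Conjugacy is therefore needed for each \<open>F\<close> separately, and \<open>g\<close> may vary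
  with \<open>F\<close>.\<close>

lemma width_one_invariant_eqI:
  assumes "0 < m" and f: "f \<in> abstract_invariants n m" and width: "inv_width n m f = 1"
    and As: "As \<in> mat_tuples n m" and Bs: "Bs \<in> mat_tuples n m"
    and conj: "\<And>F. F \<in> generic_alg n m \<Longrightarrow>
      \<exists>g \<in> GL n. [generic_subst F Bs] = conj_act n g [generic_subst F As]"
  shows "f As = f Bs"
proof -
  obtain h Fs where h: "h \<in> abstract_invariants n 1" and Fs: "length Fs = 1" "set Fs \<subseteq> generic_alg n m"
    and f_eq: "\<forall>As \<in> mat_tuples n m. f As = h (map (\<lambda>F. generic_subst F As) Fs)"
    using inv_width_attained[OF assms(1) f] unfolding width by blast
  then obtain F where F: "Fs = [F]" "F \<in> generic_alg n m"
    by (auto simp: length_Suc_conv)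
  obtain g where g: "g \<in> GL n" "[generic_subst F Bs] = conj_act n g [generic_subst F As]"
    using conj F(2) by blast
  have "[generic_subst F As] \<in> mat_tuples n 1"
    using generic_alg_carrier[OF F(2)] by (auto simp: mat_tuples_def generic_subst_def)
  then have "h [generic_subst F Bs] = h [generic_subst F As]"
    using h g by (auto simp: abstract_invariants_def)
  then show ?thesis using f_eq As Bs F(1) by auto
qed

section \<open>The algebra spanned by 1 and two matrix units of the first row\<close>

definition first_row_mat :: "nat \<Rightarrow> 'a :: semiring_1 \<Rightarrow> 'a \<Rightarrow> 'a \<Rightarrow> 'a mat" where
  "first_row_mat n c a b = mat n n (\<lambda>(i, j).
    (if j = i then c else 0) + (if j = 1 then if i = 0 then a else 0 else 0) +
    (if j = 2 then if i = 0 then b else 0 else 0))"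

lemma first_row_mat_carrier [simp]: "first_row_mat n c a b \<in> carrier_mat n n"
  by (simp add: first_row_mat_def)

lemma first_row_mat_dim [simp]:
  "dim_row (first_row_mat n c a b) = n" "dim_col (first_row_mat n c a b) = n"
  by (simp_all add: first_row_mat_def)

lemma first_row_mat_one: "1\<^sub>m n = first_row_mat n 1 0 0"
  by (rule eq_matI) (auto simp: first_row_mat_def)

lemma first_row_mat_zero: "0\<^sub>m n n = first_row_mat n 0 0 0"
  by (rule eq_matI) (auto simp: first_row_mat_def)

lemma first_row_mat_add:
  fixes a :: "'a :: comm_ring_1"
  shows "first_row_mat n c a b + first_row_mat n c' a' b' = first_row_mat n (c + c') (a + a') (b + b')"
  by (rule eq_matI) (auto simp: first_row_mat_def)

lemma first_row_mat_smult:
  fixes a :: "'a :: comm_ring_1"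
  shows "x \<cdot>\<^sub>m first_row_mat n c a b = first_row_mat n (x * c) (x * a) (x * b)"
  by (rule eq_matI) (auto simp: first_row_mat_def algebra_simps)

text \<open>The units E_12 and E_13 multiply to zero in every order, so this is multiplication in
  F[x,y]/(x,y)^2.\<close>

lemma first_row_mat_mult:
  fixes a :: "'a :: comm_ring_1"
  assumes "3 \<le> n"
  shows "first_row_mat n c a b * first_row_mat n c' a' b' =
    first_row_mat n (c * c') (c * a' + a * c') (c * b' + b * c')" (is "?L = ?R")
proof (rule eq_matI)
  fix i j assume "i < dim_row ?R" "j < dim_col ?R"
  then have ij: "i < n" "j < n" by auto
  then have "?L $$ (i, j) = (\<Sum>k = 0..<n. first_row_mat n c a b $$ (i, k) * first_row_mat n c' a' b' $$ (k, j))"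
    by (simp add: scalar_prod_def)
  \<comment> \<open>Row \<open>i\<close> of the left factor has \<open>c\<close> at position
    \<open>i\<close> and, only for \<open>i = 0\<close>, also \<open>a\<close> and \<open>b\<close>
    at positions 1 and 2.\<close>
  also have "\<dots> = (\<Sum>k = 0..<n. (if k = i then c * first_row_mat n c' a' b' $$ (i, j) else 0) +
     (if k = 1 then if i = 0 then a * first_row_mat n c' a' b' $$ (1, j) else 0 else 0) +
     (if k = 2 then if i = 0 then b * first_row_mat n c' a' b' $$ (2, j) else 0 else 0))"
    by (rule sum.cong) (use ij in \<open>auto simp: first_row_mat_def algebra_simps\<close>)
  also have "\<dots> = ?R $$ (i, j)"
    using ij assms by (auto simp: sum.distrib first_row_mat_def algebra_simps)
  finally show "?L $$ (i, j) = ?R $$ (i, j)" .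
qed auto

section \<open>The algebra of matrices paired with their transposes\<close>

text \<open>Being a relation, it follows both tuples through a single induction with the same
  \<open>c\<close>, \<open>a\<close>, \<open>b\<close> on either side.\<close>

definition transposed_pairs :: "nat \<Rightarrow> ('a :: comm_ring_1 mat \<times> 'a mat) set" where
  "transposed_pairs n =
    {(X, Y). \<exists>c a b. X = first_row_mat n c a b \<and> Y = transpose_mat (first_row_mat n c a b)}"

lemma transposed_pairsI:
  "X = first_row_mat n c a b \<Longrightarrow> Y = transpose_mat (first_row_mat n c a b) \<Longrightarrow>
    (X, Y) \<in> transposed_pairs n"
  unfolding transposed_pairs_def by blast

lemma transposed_pairs_carrier:
  "(X, Y) \<in> transposed_pairs n \<Longrightarrow> X \<in> carrier_mat n n \<and> Y \<in> carrier_mat n n"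
  by (auto simp: transposed_pairs_def)

lemma transposed_pairs_one: "(1\<^sub>m n, 1\<^sub>m n) \<in> transposed_pairs n"
  by (rule transposed_pairsI[OF first_row_mat_one]) (simp flip: first_row_mat_one)

lemma transposed_pairs_zero: "(0\<^sub>m n n, 0\<^sub>m n n) \<in> transposed_pairs n"
  by (rule transposed_pairsI[OF first_row_mat_zero]) (simp flip: first_row_mat_zero)

lemma transposed_pairs_add:
  assumes "(X, Y) \<in> transposed_pairs n" "(X', Y') \<in> transposed_pairs n"
  shows "(X + X', Y + Y') \<in> transposed_pairs n"
proof -
  obtain c a b c' a' b' where
    "X = first_row_mat n c a b" "Y = transpose_mat (first_row_mat n c a b)"
    "X' = first_row_mat n c' a' b'" "Y' = transpose_mat (first_row_mat n c' a' b')"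
    using assms unfolding transposed_pairs_def by blast
  then show ?thesis
    by (intro transposed_pairsI[of _ n "c + c'" "a + a'" "b + b'"])
      (simp_all add: first_row_mat_add flip: transpose_add[of _ n n])
qed

lemma transposed_pairs_smult:
  assumes "(X, Y) \<in> transposed_pairs n"
  shows "(x \<cdot>\<^sub>m X, x \<cdot>\<^sub>m Y) \<in> transposed_pairs n"
proof -
  obtain c a b where "X = first_row_mat n c a b" "Y = transpose_mat (first_row_mat n c a b)"
    using assms unfolding transposed_pairs_def by blast
  moreover have "x \<cdot>\<^sub>m transpose_mat Z = transpose_mat (x \<cdot>\<^sub>m Z)" for Z :: "'a mat"
    by (rule eq_matI) auto
  ultimately show ?thesis
    by (intro transposed_pairsI[of _ n "x * c" "x * a" "x * b"]) (simp_all add: first_row_mat_smult)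
qed

text \<open>Transposition reverses products, but all matrices \<^term>\<open>first_row_mat n c a b\<close> commute.\<close>

lemma transposed_pairs_mult:
  assumes "3 \<le> n" "(X, Y) \<in> transposed_pairs n" "(X', Y') \<in> transposed_pairs n"
  shows "(X * X', Y * Y') \<in> transposed_pairs n"
proof -
  obtain c a b c' a' b' where eq:
    "X = first_row_mat n c a b" "Y = transpose_mat (first_row_mat n c a b)"
    "X' = first_row_mat n c' a' b'" "Y' = transpose_mat (first_row_mat n c' a' b')"
    using assms unfolding transposed_pairs_def by blast
  have "X' * X = X * X'"
    unfolding eq first_row_mat_mult[OF assms(1)] by (simp add: algebra_simps)
  then have "Y * Y' = transpose_mat (X * X')"
    unfolding eq by (metis transpose_mult first_row_mat_carrier)
  then show ?thesis
    using transposed_pairsI eq first_row_mat_mult[OF assms(1)] by metis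
qed

section \<open>Conjugacy of the two members of a pair\<close>

lemma sum_upt_split3:
  fixes f :: "nat \<Rightarrow> 'a :: comm_monoid_add"
  assumes "3 \<le> n"
  shows "(\<Sum>k = 0..<n. f k) = f 0 + f 1 + f 2 + (\<Sum>k = 3..<n. f k)"
proof -
  have "(\<Sum>k = 0..<n. f k) = (\<Sum>k = 0..<3. f k) + (\<Sum>k = 3..<n. f k)"
    using assms by (simp add: sum.atLeastLessThan_concat)
  then show ?thesis by (simp add: numeral_3_eq_3 numeral_2_eq_2)
qed

text \<open>A symmetric \<open>g\<close> conjugates \<open>a E\<^sub>1\<^sub>2 + b E\<^sub>1\<^sub>3\<close> to its transpose as soon as it is invertible and
  its first row is \<open>(0, a, b, 0, \<dots>)\<close>.\<close>

definition sym_block :: "nat \<Rightarrow> 'a :: semiring_1 \<Rightarrow> 'a \<Rightarrow> 'a \<Rightarrow> 'a \<Rightarrow> 'a \<Rightarrow> 'a mat" where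
  "sym_block n p q y r z = mat n n (\<lambda>(i, j).
     if i \<ge> 3 \<or> j \<ge> 3 then if i = j then 1 else 0
     else [[0, p, q], [p, y, r], [q, r, z]] ! i ! j)"

lemma sym_block_carrier [simp]: "sym_block n p q y r z \<in> carrier_mat n n"
  by (simp add: sym_block_def)

lemma less_3_cases: "(i :: nat) < 3 \<Longrightarrow> i = 0 \<or> i = 1 \<or> i = 2"
  by arith

text \<open>The second matrix is the adjugate of the upper 3 by 3 block over its determinant
  \<open>-(a * a * v + b * b * u)\<close>, extended by the identity. Its corner entry would be
  \<open>u * v * (-e)\<close>, which vanishes by \<open>uv\<close>, so the inverse has the shape of
  a \<open>sym_block\<close> again.\<close>

lemma sym_block_inverse:
  fixes a b u v e :: "'a :: comm_ring_1"
  assumes n: "3 \<le> n" and uv: "u = 0 \<or> v = 0" and e: "(a * a * v + b * b * u) * e = 1"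
  shows "sym_block n a b u 0 v *
    sym_block n (a * v * e) (b * u * e) (b * b * e) (- (a * b * e)) (a * a * e) = 1\<^sub>m n"
    (is "?G * ?H = _")
proof (rule eq_matI)
  fix i j assume "i < dim_row (1\<^sub>m n :: 'a mat)" "j < dim_col (1\<^sub>m n :: 'a mat)"
  then have ij: "i < n" "j < n" by auto
  then have "(?G * ?H) $$ (i, j) = (\<Sum>k = 0..<n. ?G $$ (i, k) * ?H $$ (k, j))"
    by (simp add: scalar_prod_def sym_block_def)
  also have "\<dots> = ?G $$ (i, 0) * ?H $$ (0, j) + ?G $$ (i, 1) * ?H $$ (1, j) +
      ?G $$ (i, 2) * ?H $$ (2, j) + (\<Sum>k = 3..<n. ?G $$ (i, k) * ?H $$ (k, j))"
    by (rule sum_upt_split3[OF n])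
  \<comment> \<open>From index 3 on both matrices are the identity, so only \<open>k = i = j\<close>
    contributes.\<close>
  also have "(\<Sum>k = 3..<n. ?G $$ (i, k) * ?H $$ (k, j)) =
      (\<Sum>k = 3..<n. if k = i then if i = j then 1 else 0 else 0)"
    by (rule sum.cong) (use ij in \<open>auto simp: sym_block_def\<close>)
  also have "\<dots> = (if 3 \<le> i \<and> i = j then 1 else 0)"
    using ij by auto
  also have "?G $$ (i, 0) * ?H $$ (0, j) + ?G $$ (i, 1) * ?H $$ (1, j) +
      ?G $$ (i, 2) * ?H $$ (2, j) + \<dots> = 1\<^sub>m n $$ (i, j)"
  proof (cases "i < 3 \<and> j < 3")
    case True
    then have "i = 0 \<or> i = 1 \<or> i = 2" "j = 0 \<or> j = 1 \<or> j = 2" by arith+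
    then show ?thesis
      using n uv e by (elim disjE) (simp_all add: sym_block_def algebra_simps)
  next
    case False
    then show ?thesis using n ij by (auto simp: sym_block_def)
  qed
  finally show "(?G * ?H) $$ (i, j) = 1\<^sub>m n $$ (i, j)" .
qed (simp_all add: sym_block_def)

text \<open>Let \<open>w\<close> be the vector (0, a, b, 0, ...). Apart from the scalar part, the
  two matrices are e_0 w^T and w e_0^T. Row 0 and column 0 of \<open>?G\<close> are both
  \<open>w\<close>, so either product yields w w^T.\<close>

lemma sym_block_intertwines:
  fixes a b u v :: "'a :: comm_ring_1"
  assumes n: "3 \<le> n"
  shows "sym_block n a b u 0 v * first_row_mat n c a b =
    transpose_mat (first_row_mat n c a b) * sym_block n a b u 0 v" (is "?G * ?S = ?T * ?G")
proof (rule eq_matI)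
  fix i j assume "i < dim_row (?T * ?G)" "j < dim_col (?T * ?G)"
  then have ij: "i < n" "j < n" by (auto simp: sym_block_def)
  have "(?G * ?S) $$ (i, j) = (\<Sum>k = 0..<n. ?G $$ (i, k) * ?S $$ (k, j))"
    using ij by (simp add: scalar_prod_def sym_block_def)
  also have "\<dots> = (\<Sum>k = 0..<n. (if k = j then c * ?G $$ (i, j) else 0) +
     (if k = 0 then ?G $$ (i, 0) * ((if j = 1 then a else 0) + (if j = 2 then b else 0)) else 0))"
    by (rule sum.cong) (use ij in \<open>auto simp: first_row_mat_def algebra_simps\<close>)
  also have "\<dots> = c * ?G $$ (i, j) +
     ?G $$ (i, 0) * ((if j = 1 then a else 0) + (if j = 2 then b else 0))"
    using ij by (simp add: sum.distrib)
  \<comment> \<open>Here the symmetry enters: both second summands are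
    \<open>w_i * w_j\<close>.\<close>
  also have "\<dots> = c * ?G $$ (i, j) +
     ?G $$ (0, j) * ((if i = 1 then a else 0) + (if i = 2 then b else 0))"
    using ij n by (auto simp: sym_block_def not_le dest!: less_3_cases)
  also have "\<dots> = (\<Sum>k = 0..<n. (if k = i then c * ?G $$ (i, j) else 0) +
     (if k = 0 then ?G $$ (0, j) * ((if i = 1 then a else 0) + (if i = 2 then b else 0)) else 0))"
    using ij by (simp add: sum.distrib)
  also have "\<dots> = (\<Sum>k = 0..<n. ?T $$ (i, k) * ?G $$ (k, j))"
    by (rule sum.cong) (use ij in \<open>auto simp: first_row_mat_def algebra_simps\<close>)
  also have "\<dots> = (?T * ?G) $$ (i, j)"
    using ij by (simp add: scalar_prod_def sym_block_def)
  finally show "(?G * ?S) $$ (i, j) = (?T * ?G) $$ (i, j)" .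
qed (simp_all add: sym_block_def)

text \<open>Over a field a right inverse is also a left inverse, so one matrix equation determines
  the inverse in the matrix ring.\<close>

lemma GL_inverse:
  fixes g h :: "'a :: field mat"
  assumes "g \<in> carrier_mat n n" "h \<in> carrier_mat n n" "g * h = 1\<^sub>m n"
  shows "g \<in> GL n" "inv\<^bsub>ring_mat TYPE('a) n ()\<^esub> g = h"
proof -
  interpret ring "ring_mat TYPE('a) n ()" by (rule ring_mat)
  have "h * g = 1\<^sub>m n" using assms by (rule mat_mult_left_right_inverse)
  then show "inv\<^bsub>ring_mat TYPE('a) n ()\<^esub> g = h"
    using assms by (intro inv_char) (auto simp: ring_mat_simps)
  show "g \<in> GL n"
    using assms \<open>h * g = 1\<^sub>m n\<close> by (auto simp: GL_def Units_def ring_mat_simps)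
qed

lemma transposed_pairs_conj:
  fixes X Y :: "'a :: field mat"
  assumes n: "3 \<le> n" and XY: "(X, Y) \<in> transposed_pairs n"
  shows "\<exists>g \<in> GL n. [Y] = conj_act n g [X]"
proof -
  obtain c a b where X: "X = first_row_mat n c a b" and Y: "Y = transpose_mat X"
    using XY unfolding transposed_pairs_def by blast
  have carr: "X \<in> carrier_mat n n" "Y \<in> carrier_mat n n" by (simp_all add: X Y)
  have "\<exists>g h. g \<in> carrier_mat n n \<and> h \<in> carrier_mat n n \<and> g * h = 1\<^sub>m n \<and> g * X = Y * g"
  proof (cases "a = 0 \<and> b = 0")
    case True
    then have "Y = X" unfolding X Y by (intro eq_matI) (auto simp: first_row_mat_def)
    then show ?thesis using carr by (intro exI[of _ "1\<^sub>m n"]) auto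
  next
    case False
    \<comment> \<open>This choice turns \<open>a * a * v + b * b * u\<close> into the square of one
      nonzero entry. The sum \<open>a * a + b * b\<close> could vanish over some fields.\<close>
    define u v :: 'a where "u = (if a = 0 then 1 else 0)" and "v = (if a = 0 then 0 else 1)"
    have "u = 0 \<or> v = 0" "(a * a * v + b * b * u) * inverse (a * a * v + b * b * u) = 1"
      using False by (auto simp: u_def v_def)
    then show ?thesis
      using sym_block_inverse[OF n] sym_block_intertwines[OF n] unfolding X Y
      by (meson sym_block_carrier)
  qed
  then obtain g h where gh: "g \<in> carrier_mat n n" "h \<in> carrier_mat n n" "g * h = 1\<^sub>m n"
    and eq: "g * X = Y * g" by blast
  have "g * X * h = Y"
    using gh carr by (simp add: eq assoc_mult_mat[of _ n n _ n _ n])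
  then show ?thesis
    using GL_inverse[OF gh] by (intro bexI[of _ g]) (simp_all add: conj_act_def)
qed

section \<open>Equality of ranks\<close>

text \<open>An outer product has rank at most 1, and its nonzero column \<open>j\<close> is by
  itself an independent set of columns.\<close>

lemma (in vec_space) rank_eq_1I:
  assumes A: "A \<in> carrier_mat n nc"
    and prod: "\<And>r c. r < n \<Longrightarrow> c < nc \<Longrightarrow> A $$ (r, c) = f r * g c"
    and ij: "i < n" "j < nc" "A $$ (i, j) \<noteq> 0"
  shows "rank A = 1"
proof (rule antisym)
  show "rank A \<le> 1"
    by (rule rank_le_1_product_entries[OF A]) (use A prod in auto)
  have "col A j \<noteq> 0\<^sub>v n"
    using A ij by (metis carrier_matD index_col index_zero_vec(1))
  then have "col A j \<notin> span {}" by (simp add: span_empty)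
  moreover have "lin_indpt {}" by (rule finite_lin_indpt2) auto
  moreover have "col A j \<in> carrier_vec n" using A by auto
  ultimately have "lin_indpt ({} \<union> {col A j})"
    by (subst lin_dep_iff_in_span[symmetric]) auto
  then have "lin_indpt {col A j}" by simp
  moreover have "{col A j} \<subseteq> set (cols A)"
    using A ij by (auto simp: cols_def)
  ultimately have "card {col A j} \<le> rank A" by (rule rank_ge_card_indpt[OF A, rotated])
  then show "1 \<le> rank A" by simp
qed

lemma transposed_pairs_rank:
  fixes X Y :: "'a :: field mat"
  assumes n: "3 \<le> n" and XY: "(X, Y) \<in> transposed_pairs n"
  shows "vec_space.rank n X = vec_space.rank n Y"
proof -
  obtain c a b where X: "X = first_row_mat n c a b" and Y: "Y = transpose_mat X"
    using XY unfolding transposed_pairs_def by blast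
  have carr: "X \<in> carrier_mat n n" "Y \<in> carrier_mat n n" by (simp_all add: X Y)
  consider "c \<noteq> 0" | "c = 0" "a = 0" "b = 0" | "c = 0" "a \<noteq> 0 \<or> b \<noteq> 0" by blast
  then show ?thesis
  proof cases
    case 1
    \<comment> \<open>For \<open>t\<close> with t^2 = 0 the inverse of c + t is 1/c - t/c^2.\<close>
    have "X * first_row_mat n (1 / c) (- a / (c * c)) (- b / (c * c)) = 1\<^sub>m n"
      unfolding X first_row_mat_mult[OF n] first_row_mat_one using 1 by (simp add: field_simps)
    then have "det X * det (first_row_mat n (1 / c) (- a / (c * c)) (- b / (c * c))) = 1"
      using det_mult[OF carr(1)] by (metis det_one first_row_mat_carrier)
    then have "det X \<noteq> 0" "det Y \<noteq> 0" using det_transpose[OF carr(1)] Y by auto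
    then show ?thesis using carr vec_space.low_rank_det_zero by metis
  next
    case 2
    then have "X = 0\<^sub>m n n" using X first_row_mat_zero by metis
    then have "Y = X" using Y by simp
    then show ?thesis by simp
  next
    case 3
    \<comment> \<open>With \<open>c = 0\<close> the matrix \<open>X\<close> is the outer product of
      \<open>e\<close> and \<open>w\<close>, and \<open>Y\<close> that of \<open>w\<close> and
      \<open>e\<close>.\<close>
    define e w :: "nat \<Rightarrow> 'a" where "e = (\<lambda>i. if i = 0 then 1 else 0)"
      and "w = (\<lambda>j. if j = 1 then a else if j = 2 then b else 0)"
    have prod: "X $$ (i, j) = e i * w j" "Y $$ (j, i) = w j * e i" if "i < n" "j < n" for i j
      using that 3 by (auto simp: X Y first_row_mat_def e_def w_def)
    obtain j where "j < n" "X $$ (0, j) \<noteq> 0" "Y $$ (j, 0) \<noteq> 0"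
      using 3 n that[of 1] that[of 2] by (auto simp: X Y first_row_mat_def)
    then have "vec_space.rank n X = 1" "vec_space.rank n Y = 1"
      using vec_space.rank_eq_1I[OF carr(1), of e w 0 j] vec_space.rank_eq_1I[OF carr(2), of w e j 0]
        prod n by auto
    then show ?thesis by simp
  qed
qed

section \<open>The two tuples\<close>

definition row_tuple :: "nat \<Rightarrow> nat \<Rightarrow> 'a :: comm_ring_1 mat list" where
  "row_tuple n m =
    map (\<lambda>k. first_row_mat n 0 (if k = 0 then 1 else 0) (if k = 1 then 1 else 0)) [0..<m]"

definition col_tuple :: "nat \<Rightarrow> nat \<Rightarrow> 'a :: comm_ring_1 mat list" where
  "col_tuple n m = map transpose_mat (row_tuple n m)"

lemma row_tuple_in: "row_tuple n m \<in> mat_tuples n m"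
  by (auto simp: row_tuple_def mat_tuples_def)

lemma col_tuple_in: "col_tuple n m \<in> mat_tuples n m"
  by (auto simp: col_tuple_def row_tuple_def mat_tuples_def)

lemma row_col_tuple_nth:
  "k < m \<Longrightarrow> (row_tuple n m ! k, col_tuple n m ! k) \<in> transposed_pairs n"
  by (auto simp: row_tuple_def col_tuple_def intro!: transposed_pairsI)

text \<open>The generators take values in \<open>transposed_pairs\<close>, which is closed under the
  operations of the algebra.\<close>

lemma generic_subst_transposed_pairs:
  assumes n: "3 \<le> n" and "F \<in> generic_alg n m"
  shows "(generic_subst F (row_tuple n m), generic_subst F (col_tuple n m)) \<in> transposed_pairs n"
  using assms(2)
proof induction
  case (gen k)
  then show ?case
    using row_col_tuple_nth[of k m n] transposed_pairs_carrier
    by (metis generic_subst_generic_mat)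
next
  case one
  show ?case by (simp add: generic_subst_one transposed_pairs_one)
next
  case (add F G)
  then show ?case
    by (simp add: generic_subst_add[of _ n] generic_alg_carrier transposed_pairs_add)
next
  case (mult F G)
  then show ?case
    by (simp add: generic_subst_mult[of _ n] generic_alg_carrier transposed_pairs_mult n)
next
  case (scale F c)
  then show ?case
    by (simp add: generic_subst_scale transposed_pairs_smult)
qed

lemma word_eval_transposed_pairs:
  assumes n: "3 \<le> n" and "w \<in> lists {..<m}"
  shows "(word_eval n (row_tuple n m) w, word_eval n (col_tuple n m) w) \<in> transposed_pairs n"
  using assms(2)
  by induction
    (auto simp: word_eval_def transposed_pairs_one intro!: transposed_pairs_mult n row_col_tuple_nth)

lemma finsum_transposed_pairs:
  fixes p q :: "'b \<Rightarrow> 'a :: comm_ring_1 mat"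
  assumes "finite S" "\<And>w. w \<in> S \<Longrightarrow> (p w, q w) \<in> transposed_pairs n"
  shows "(finsum (ring_mat TYPE('a) n ()) p S, finsum (ring_mat TYPE('a) n ()) q S)
    \<in> transposed_pairs n"
proof -
  interpret ring "ring_mat TYPE('a) n ()" by (rule ring_mat)
  show ?thesis
    using assms
  proof (induction S)
    case empty
    show ?case by (simp add: ring_mat_simps transposed_pairs_zero)
  next
    case (insert w S)
    have "p \<in> insert w S \<rightarrow> carrier_mat n n" "q \<in> insert w S \<rightarrow> carrier_mat n n"
      using insert.prems transposed_pairs_carrier by blast+
    then have "finsum (ring_mat TYPE('a) n ()) p (insert w S) = p w + finsum (ring_mat TYPE('a) n ()) p S"
      "finsum (ring_mat TYPE('a) n ()) q (insert w S) = q w + finsum (ring_mat TYPE('a) n ()) q S"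
      using insert.hyps by (subst finsum_insert; auto simp: ring_mat_simps)+
    then show ?case using insert by (simp add: transposed_pairs_add)
  qed
qed

lemma nc_eval_transposed_pairs:
  assumes "3 \<le> n" and "f \<in> nc_polys m"
  shows "(nc_eval n f (row_tuple n m), nc_eval n f (col_tuple n m)) \<in> transposed_pairs n"
  unfolding nc_eval_def
  by (rule finsum_transposed_pairs)
    (use assms in \<open>auto simp: nc_polys_def intro!: transposed_pairs_smult word_eval_transposed_pairs\<close>)

text \<open>If \<open>g\<close> carried the column tuple to the row tuple, then the rows 1 and 2 of \<open>g\<close> would both
  vanish off column 0, so \<open>g\<close> would be singular.\<close>

lemma row_tuple_not_in_orbit:
  assumes n: "3 \<le> n" and m: "2 \<le> m"
  shows "(row_tuple n m :: 'a :: field mat list) \<notin> GL_orbit n (col_tuple n m)"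
proof
  assume "(row_tuple n m :: 'a mat list) \<in> GL_orbit n (col_tuple n m)"
  then obtain g :: "'a mat" where g: "g \<in> GL n" and "row_tuple n m = conj_act n g (col_tuple n m)"
    unfolding GL_orbit_def by blast
  moreover obtain h where h: "g \<in> carrier_mat n n" "h \<in> carrier_mat n n" "g * h = 1\<^sub>m n" "h * g = 1\<^sub>m n"
    using g by (auto simp: GL_def Units_def ring_mat_simps)
  ultimately have conj: "row_tuple n m = map (\<lambda>A. g * A * h) (col_tuple n m)"
    using GL_inverse(2)[OF h(1-3)] by (simp add: conj_act_def)
  have row_zero: "g $$ (Suc k, j) = 0" if k: "k < 2" and j: "j < n" "j \<noteq> 0" for k j
  proof -
    let ?A = "row_tuple n m ! k :: 'a mat" and ?B = "col_tuple n m ! k :: 'a mat"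
    have AB: "?A \<in> carrier_mat n n" "?B \<in> carrier_mat n n"
      using k m transposed_pairs_carrier[OF row_col_tuple_nth[of k m n]] by auto
    have "?A = g * ?B * h"
      using k m by (subst conj) (simp add: col_tuple_def row_tuple_def)
    \<comment> \<open>The entries (0, j) of the two sides are compared next. Row 0 of
      \<open>?A\<close> is the unit vector at \<open>Suc k\<close>, so the left side picks out
      \<open>g $$ (Suc k, j)\<close>. Column \<open>j\<close> of \<open>?B\<close> is zero since
      \<open>j\<close> is not 0, so the right side vanishes.\<close>
    then have eq: "?A * g = g * ?B"
      using h AB by (simp add: assoc_mult_mat[of _ n n _ n _ n])
    have A: "?A $$ (0, l) = (if l = Suc k then 1 else 0)" if "l < n" for l
      using that k m by (auto simp: row_tuple_def first_row_mat_def)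
    have B: "?B $$ (l, j) = 0" if "l < n" for l
      using that j k m by (auto simp: col_tuple_def row_tuple_def first_row_mat_def)
    have "(?A * g) $$ (0, j) = (\<Sum>l = 0..<n. (if l = Suc k then g $$ (l, j) else 0))"
    proof -
      have "(?A * g) $$ (0, j) = (\<Sum>l = 0..<n. ?A $$ (0, l) * g $$ (l, j))"
        using AB h j by (auto simp: scalar_prod_def intro!: sum.cong)
      also have "\<dots> = (\<Sum>l = 0..<n. (if l = Suc k then g $$ (l, j) else 0))"
        by (rule sum.cong) (simp_all add: A)
      finally show ?thesis .
    qed
    also have "\<dots> = g $$ (Suc k, j)" using k n by simp
    finally have "g $$ (Suc k, j) = (g * ?B) $$ (0, j)" using eq by simp
    also have "\<dots> = (\<Sum>l = 0..<n. g $$ (0, l) * ?B $$ (l, j))"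
      using AB h j by (auto simp: scalar_prod_def intro!: sum.cong)
    also have "\<dots> = 0" using B by simp
    finally show ?thesis .
  qed
  \<comment> \<open>Only column 0 of \<open>g\<close> survives in rows 1 and 2, so these rows of
    \<open>g * h\<close> are multiples of row 0 of \<open>h\<close>. Rows 1 and 2 of the identity
    are independent.\<close>
  have prod: "(g * h) $$ (Suc k, j) = g $$ (Suc k, 0) * h $$ (0, j)" if "k < 2" "j < n" for k j
  proof -
    have "(g * h) $$ (Suc k, j) = (\<Sum>l = 0..<n. g $$ (Suc k, l) * h $$ (l, j))"
      using that h(1,2) n by (auto simp: scalar_prod_def intro!: sum.cong)
    also have "\<dots> = (\<Sum>l = 0..<n. if l = 0 then g $$ (Suc k, 0) * h $$ (0, j) else 0)"
      by (rule sum.cong) (use row_zero that in auto)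
    finally show ?thesis using n by simp
  qed
  \<comment> \<open>These are the entries (1,1), (1,2) and (2,2) of \<open>g * h = 1\<close>. The
    first makes \<open>g $$ (1, 0)\<close> nonzero, the second then forces
    \<open>h $$ (0, 2) = 0\<close>, against the third.\<close>
  have "g $$ (1, 0) * h $$ (0, 1) = 1" "g $$ (1, 0) * h $$ (0, 2) = 0"
    "g $$ (2, 0) * h $$ (0, 2) = 1"
    using prod[of 0 1] prod[of 0 2] prod[of 1 2] n h(3) by (auto simp: numeral_2_eq_2)
  then show False by auto
qed

text \<open>The identity matrix puts the row tuple in its own orbit, so equal orbits would
  contradict \<open>row_tuple_not_in_orbit\<close>.\<close>

lemma row_col_tuple_orbits:
  assumes n: "3 \<le> n" and m: "2 \<le> m"
  shows "GL_orbit n (row_tuple n m :: 'a :: field mat list) \<noteq> GL_orbit n (col_tuple n m)"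
proof -
  let ?A = "row_tuple n m :: 'a mat list"
  have one: "(1\<^sub>m n :: 'a mat) \<in> GL n" "inv\<^bsub>ring_mat TYPE('a) n ()\<^esub> (1\<^sub>m n) = 1\<^sub>m n"
    using GL_inverse[of "1\<^sub>m n :: 'a mat" n "1\<^sub>m n"] by auto
  have "conj_act n (1\<^sub>m n) ?A = map (\<lambda>A. A) ?A"
    unfolding conj_act_def one(2)
    by (rule map_cong) (use row_tuple_in[of n m] in \<open>auto simp: mat_tuples_def\<close>)
  then have "?A \<in> GL_orbit n ?A"
    unfolding GL_orbit_def using one(1) by (metis image_eqI map_ident)
  then show ?thesis using row_tuple_not_in_orbit[OF assms] by blast
qed

theorem lemma5p1:
  fixes n m :: nat
  assumes "3 \<le> n" and "2 \<le> m"
  shows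
    "(\<exists>As \<in> mat_tuples n m. \<exists>Bs \<in> mat_tuples n m :: 'a :: field mat list set.
        GL_orbit n As \<noteq> GL_orbit n Bs \<and>
        (\<forall>f \<in> abstract_invariants n m. inv_width n m f = 1 \<longrightarrow> f As = f Bs)) \<and>
     \<not> two_sided_curto_herrero TYPE('a) n m \<and>
     (\<exists>As \<in> mat_tuples n m. \<exists>Bs \<in> mat_tuples n m :: 'a mat list set.
        GL_orbit n As \<noteq> GL_orbit n Bs \<and>
        (\<forall>f \<in> nc_polys m.
           vec_space.rank n (nc_eval n f As) = vec_space.rank n (nc_eval n f Bs)))"
proof -
  let ?A = "row_tuple n m :: 'a mat list" and ?B = "col_tuple n m :: 'a mat list"
  have inv: "f ?A = f ?B" if "f \<in> abstract_invariants n m" "inv_width n m f = 1" for f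
    using assms that row_tuple_in col_tuple_in
    by (intro width_one_invariant_eqI[of m f n])
      (auto intro: transposed_pairs_conj generic_subst_transposed_pairs)
  have rank: "vec_space.rank n (nc_eval n f ?A) = vec_space.rank n (nc_eval n f ?B)"
    if "f \<in> nc_polys m" for f
    using transposed_pairs_rank nc_eval_transposed_pairs assms that by blast
  note orbits = row_col_tuple_orbits[OF assms, where 'a = 'a]
  \<comment> \<open>The same two tuples violate the direction from equal ranks to equal
    orbits.\<close>
  have "\<not> two_sided_curto_herrero TYPE('a) n m"
    unfolding two_sided_curto_herrero_def
    using orbits rank row_tuple_in col_tuple_in by blast
  then show ?thesis
    using orbits inv rank row_tuple_in col_tuple_in by blast
qed

end
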